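(* Let $\mathcal{R}$ be a ring and $a\in\mathcal{R}$. Then (i) $a$ is left Drazin invertible if and only if $a$ is left strongly $\pi$-regular. (ii) $a$ is right Drazin invertible if and only if $a$ is right strongly $\pi$-regular.
   Context: Rings are associative with unit. Let $a\in\mathcal{R}$. - $a$ is left Drazin invertible if there exist $x\in\mathcal{R}$ and a non-negative integer $j$ such that $axa=xa^2$, $x^2a=x$, $xa^{j+1}=a^j$. - $a$ is right Drazin invertible if there exist $y\in\mathcal{R}$ and a non-negative integer $j$ such that $aya=a^2y$, $ay^2=y$, $a^{j+1}y=a^j$. - $a$ is left strongly $\pi$-regular if there exist $x\in\mathcal{R}$ and a non-negative integer $p$ such that $axa=xa^2$ and $xa^{p+1}=a^p$. - $a$ is right strongly $\pi$-regular if there exist $y\in\mathcal{R}$ and a non-negative integer $q$ such that $aya=a^2y$ and $a^{q+1}y=a^q$. *)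

theory Defs
  imports Main
begin

text \<open>Associative rings with unit are rendered by the sort \<open>{ring, monoid_mult}\<close>; unlike
  \<open>ring_1\<close>, it does not demand \<open>0 \<noteq> 1\<close>, so the zero ring is included. Since \<open>a ^ 0 = 1\<close>,
  the index \<open>j = 0\<close> gives one-sided invertibility.\<close>

definition left_Drazin_invertible :: "'a::{ring, monoid_mult} \<Rightarrow> bool" where
  "left_Drazin_invertible a \<longleftrightarrow>
     (\<exists>x. \<exists>j::nat. a * x * a = x * a\<^sup>2 \<and> x\<^sup>2 * a = x \<and> x * a ^ (j + 1) = a ^ j)"

definition right_Drazin_invertible :: "'a::{ring, monoid_mult} \<Rightarrow> bool" where
  "right_Drazin_invertible a \<longleftrightarrow>
     (\<exists>y. \<exists>j::nat. a * y * a = a\<^sup>2 * y \<and> a * y\<^sup>2 = y \<and> a ^ (j + 1) * y = a ^ j)"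

definition left_strongly_pi_regular :: "'a::{ring, monoid_mult} \<Rightarrow> bool" where
  "left_strongly_pi_regular a \<longleftrightarrow>
     (\<exists>x. \<exists>p::nat. a * x * a = x * a\<^sup>2 \<and> x * a ^ (p + 1) = a ^ p)"

definition right_strongly_pi_regular :: "'a::{ring, monoid_mult} \<Rightarrow> bool" where
  "right_strongly_pi_regular a \<longleftrightarrow>
     (\<exists>y. \<exists>q::nat. a * y * a = a\<^sup>2 * y \<and> a ^ (q + 1) * y = a ^ q)"

end

theory Submission
  imports Defs
begin

text \<open>Each Drazin property contains the corresponding \<open>\<pi>\<close>-regularity, so the content is to
  enforce \<open>z\<^sup>2 * a = z\<close>. Put \<open>e = x * a\<close>. The identity \<open>a * x * a = x * a\<^sup>2\<close> says exactly that
  \<open>e\<close> commutes with \<open>a\<close>, and this yields \<open>e ^ n = x ^ n * a ^ n\<close>. The identity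
  \<open>x * a ^ (p + 1) = a ^ p\<close> says that \<open>e\<close> fixes \<open>a ^ p\<close>, so multiplication by \<open>e\<close> on the right
  also fixes \<open>e ^ p = x ^ p * a ^ p\<close>: the powers of \<open>e\<close> are constant from
  exponent \<open>p\<close> on, and \<open>e ^ p\<close> is idempotent. Cutting \<open>x\<close> down by this idempotent gives
  \<open>z = x * e ^ p\<close>. Then \<open>z * a = e ^ p\<close> still commutes with \<open>a\<close> and fixes \<open>a ^ p\<close>, while
  \<open>z\<^sup>2 * a = x * e ^ p * e ^ p = z\<close>. The right-hand case is the mirror image, with \<open>f = a * y\<close>
  and \<open>z = f ^ q * y\<close>. The index of \<open>\<pi>\<close>-regularity serves unchanged as the Drazin index.\<close>

text \<open>The factors \<open>x\<close> and \<open>a\<close> need not commute. The induction works because a product \<open>x * a\<close>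
  that commutes with \<open>a\<close> can be collected from the inside out:
  \<open>x * (x * a) ^ n * a = (x * a) * (x * a) ^ n\<close>.\<close>

lemma power_mult_if_commutes_right:
  fixes a x :: "'a::monoid_mult"
  assumes "a * (x * a) = (x * a) * a"
  shows "(x * a) ^ n = x ^ n * a ^ n"
proof (induction n)
  case (Suc n)
  have "x ^ Suc n * a ^ Suc n = x * (x ^ n * a ^ n) * a"
    by (simp add: mult.assoc power_commutes)
  also have "\<dots> = x * ((x * a) ^ n * a)"
    using Suc by (simp add: mult.assoc)
  also have "\<dots> = x * (a * (x * a) ^ n)"
    using power_commuting_commutes[of "x * a" a n] assms by simp
  finally show ?case
    by (simp add: mult.assoc)
qed simp

lemma power_mult_if_commutes_left:
  fixes a y :: "'a::monoid_mult"
  assumes "a * (a * y) = (a * y) * a"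
  shows "(a * y) ^ n = a ^ n * y ^ n"
proof (induction n)
  case (Suc n)
  have "a ^ Suc n * y ^ Suc n = a * (a ^ n * y ^ n) * y"
    by (simp add: mult.assoc power_commutes)
  also have "\<dots> = (a * (a * y) ^ n) * y"
    using Suc by simp
  also have "\<dots> = (a * y) ^ n * (a * y)"
    by (simp only: power_commuting_commutes[OF assms[symmetric], symmetric] mult.assoc)
  finally show ?case
    by (simp only: power_Suc2)
qed simp

lemma power_eq_if_fixed:
  fixes e b :: "'a::monoid_mult"
  assumes "e * b = b"
  shows "e ^ n * b = b"
  by (induction n) (simp_all add: assms mult.assoc)

lemma fixed_power_eq:
  fixes e b :: "'a::monoid_mult"
  assumes "b * e = b"
  shows "b * e ^ n = b"
  by (induction n) (simp_all add: assms mult.assoc[symmetric])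

text \<open>The exponent \<open>p\<close> in the witness makes \<open>(x * a) ^ p\<close> idempotent: the product
  \<open>x ^ p * a ^ p\<close> ends in \<open>a ^ p\<close>, which absorbs \<open>x * a\<close>.\<close>

lemma left_Drazin_inverse_from_pi_regular:
  fixes a x :: "'a::monoid_mult"
  assumes comm: "a * x * a = x * a\<^sup>2" and reg: "x * a ^ (p + 1) = a ^ p"
  defines "z \<equiv> x * (x * a) ^ p"
  shows "a * z * a = z * a\<^sup>2" "z\<^sup>2 * a = z" "z * a ^ (p + 1) = a ^ p"
proof -
  define e where "e = x * a"
  have ae: "a * e = e * a"
    using comm by (simp add: e_def power2_eq_square mult.assoc)
  have a_pow: "e ^ n * a = a * e ^ n" for n
    using power_commuting_commutes[of e a n] ae by simp
  have fix_a: "e * a ^ p = a ^ p"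
    using reg by (simp add: e_def mult.assoc)
  \<comment> \<open>\<open>e\<close> need not commute with \<open>x\<close>, but it can be moved past \<open>a ^ p\<close>, which it fixes.\<close>
  have "e ^ p * e = x ^ p * (a ^ p * e)"
    using power_mult_if_commutes_right[of a x p] ae by (simp add: e_def mult.assoc)
  also have "a ^ p * e = e * a ^ p"
    using power_commuting_commutes[of a e p] ae by simp
  finally have fix_e: "e ^ p * e = e ^ p"
    using power_mult_if_commutes_right[of a x p] ae fix_a by (simp add: e_def)
  have za: "z * a = e ^ p"
  proof -
    have "z * a = x * (a * e ^ p)"
      using a_pow by (simp add: z_def e_def[symmetric] mult.assoc)
    also have "\<dots> = e ^ p * e"
      by (simp add: e_def mult.assoc power_commutes)
    finally show ?thesis
      using fix_e by simp
  qed
  show "a * z * a = z * a\<^sup>2"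
    using za a_pow[of p] by (metis mult.assoc power2_eq_square)
  have "z\<^sup>2 * a = x * (e ^ p * e ^ p)"
    using za by (simp add: power2_eq_square mult.assoc) (simp add: z_def e_def mult.assoc)
  then show "z\<^sup>2 * a = z"
    using fixed_power_eq[OF fix_e] by (simp add: z_def e_def)
  have "z * a ^ (p + 1) = e ^ p * a ^ p"
    using za by (simp add: mult.assoc[symmetric])
  then show "z * a ^ (p + 1) = a ^ p"
    using power_eq_if_fixed[OF fix_a] by simp
qed

text \<open>Mirror image: the idempotent \<open>(a * y) ^ q = a ^ q * y ^ q\<close> now begins with \<open>a ^ q\<close>, so
  \<open>a * y\<close> is absorbed on the left, and the idempotent multiplies \<open>y\<close> from the left.\<close>

lemma right_Drazin_inverse_from_pi_regular:
  fixes a y :: "'a::monoid_mult"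
  assumes comm: "a * y * a = a\<^sup>2 * y" and reg: "a ^ (q + 1) * y = a ^ q"
  defines "z \<equiv> (a * y) ^ q * y"
  shows "a * z * a = a\<^sup>2 * z" "a * z\<^sup>2 = z" "a ^ (q + 1) * z = a ^ q"
proof -
  define f where "f = a * y"
  have af: "a * f = f * a"
    using comm by (simp add: f_def power2_eq_square mult.assoc)
  have a_pow: "f ^ n * a = a * f ^ n" for n
    using power_commuting_commutes[of f a n] af by simp
  have fix_a: "a ^ q * f = a ^ q"
    using reg by (simp add: f_def mult.assoc[symmetric] power_commutes)
  have "f * f ^ q = (f * a ^ q) * y ^ q"
    using power_mult_if_commutes_left[of a y q] af by (simp add: f_def mult.assoc)
  also have "f * a ^ q = a ^ q * f"
    using power_commuting_commutes[of a f q] af by simp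
  finally have fix_f: "f * f ^ q = f ^ q"
    using power_mult_if_commutes_left[of a y q] af fix_a by (simp add: f_def)
  have az: "a * z = f ^ q"
  proof -
    have "a * z = f ^ q * a * y"
      using a_pow by (simp add: z_def f_def[symmetric] mult.assoc)
    also have "\<dots> = f * f ^ q"
      by (simp add: f_def[symmetric] mult.assoc power_commutes)
    finally show ?thesis
      using fix_f by simp
  qed
  show "a * z * a = a\<^sup>2 * z"
    using az a_pow[of q] by (metis mult.assoc power2_eq_square)
  have "a * z\<^sup>2 = (f ^ q * f ^ q) * y"
    using az by (simp add: power2_eq_square mult.assoc[symmetric])
      (simp add: z_def f_def mult.assoc)
  then show "a * z\<^sup>2 = z"
    using power_eq_if_fixed[OF fix_f] by (simp add: z_def f_def)
  have "a ^ (q + 1) * z = a ^ q * f ^ q"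
    using az by (simp only: Suc_eq_plus1[symmetric] power_Suc2 mult.assoc)
  then show "a ^ (q + 1) * z = a ^ q"
    using fixed_power_eq[OF fix_a] by simp
qed

theorem theorem2p6:
  fixes a :: "'a::{ring, monoid_mult}"
  shows "(left_Drazin_invertible a \<longleftrightarrow> left_strongly_pi_regular a) \<and>
         (right_Drazin_invertible a \<longleftrightarrow> right_strongly_pi_regular a)"
proof (intro conjI iffI)
  assume "left_strongly_pi_regular a"
  then show "left_Drazin_invertible a"
    unfolding left_strongly_pi_regular_def left_Drazin_invertible_def
    by (blast dest: left_Drazin_inverse_from_pi_regular)
next
  assume "right_strongly_pi_regular a"
  then show "right_Drazin_invertible a"
    unfolding right_strongly_pi_regular_def right_Drazin_invertible_def
    by (blast dest: right_Drazin_inverse_from_pi_regular)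
qed (auto simp: left_Drazin_invertible_def left_strongly_pi_regular_def
      right_Drazin_invertible_def right_strongly_pi_regular_def)

end
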